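(* Let $S^k=(I^k,U^k)$ be a finite connected directed network without loops and multiple arcs ($k$ a fixed label), let $U_T^k\subseteq U^k$ be a spanning tree of $S^k$, and consider the linear system $$\sum_{j\in I_i^+(U^k)}x_{ij}^k-\sum_{j\in I_i^-(U^k)}x_{ji}^k=a_i^k,\qquad i\in I^k,\qquad ( * )$$ with real right-hand sides $a_i^k$ and unknowns $x^k=(x_{ij}^k,(i,j)^k\in U^k)$. Let $\tilde x^k=(\tilde x_{ij}^k,(i,j)^k\in U^k)$ be any particular solution of $( * )$. Then the general solution of $( * )$ is given by $$x_{ij}^k=\sum_{(\tau,\rho)^k\in U^k\setminus U_T^k}x_{\tau\rho}^k\,\mathrm{sign}(i,j)^{L_{\tau\rho}^k}+\Big(\tilde x_{ij}^k-\sum_{(\tau,\rho)^k\in U^k\setminus U_T^k}\tilde x_{\tau\rho}^k\,\mathrm{sign}(i,j)^{L_{\tau\rho}^k}\Big),\qquad (i,j)^k\in U_T^k,$$ $$x_{\tau\rho}^k\in\mathbf{R},\qquad (\tau,\rho)^k\in U^k\setminus U_T^k,$$ where the $x_{\tau\rho}^k$, $(\tau,\rho)^k\in U^k\setminus U_T^k$, are independent (free) variables. That is, a vector $x^k\in\mathbf{R}^{U^k}$ solves $( * )$ if and only if its components on $U_T^k$ are expressed through its (arbitrary) components on $U^k\setminus U_T^k$ by the displayed formula.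
   Context: Arcs of $U^k$ are written $(i,j)^k$ (directed from $i$ to $j$); connectedness, trees and cycles are understood ignoring orientation. $I_i^+(U^k)=\{j\in I^k:(i,j)^k\in U^k\}$, $I_i^-(U^k)=\{j\in I^k:(j,i)^k\in U^k\}$. A spanning tree of $S^k$ is a set of arcs of $U^k$ that, ignoring orientation, forms a tree on the whole node set $I^k$. For $(\tau,\rho)^k\in U^k\setminus U_T^k$, $L_{\tau\rho}^k$ denotes the (arc set of the) unique cycle in the network $(I^k,U_T^k\cup\{(\tau,\rho)^k\})$. The cycle is traversed in the direction given by the arc $(\tau,\rho)^k$. An arc of the cycle is forward if its direction agrees with this traversal direction, and backward if it is opposite (so $(\tau,\rho)^k$ itself is forward). For $(i,j)^k\in U^k$ put $\mathrm{sign}(i,j)^{L_{\tau\rho}^k}=1$ if $(i,j)^k$ is a forward arc of $L_{\tau\rho}^k$, $-1$ if it is a backward arc of $L_{\tau\rho}^k$, and $0$ if $(i,j)^k\notin L_{\tau\rho}^k$. *)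

theory Defs
  imports Complex_Main "Graph_Theory.Graph_Theory"
begin

text \<open>
  A network is a \<^typ>\<open>'a pair_pre_digraph\<close> with node set \<^term>\<open>pverts S\<close> and arc set
  \<^term>\<open>parcs S\<close>; since arcs are ordered pairs, there are no multiple arcs. Opposite arcs
  \<open>(i, j)\<close> and \<open>(j, i)\<close> may both be present; ignoring orientation they form a cycle of length 2.
  A vector indexed by the arcs is a function on pairs of nodes, whose values outside
  \<^term>\<open>parcs S\<close> are irrelevant.
\<close>

definition I_plus :: "'a pair_pre_digraph \<Rightarrow> 'a \<Rightarrow> 'a set" where
  "I_plus S i = {j \<in> pverts S. (i, j) \<in> parcs S}"

definition I_minus :: "'a pair_pre_digraph \<Rightarrow> 'a \<Rightarrow> 'a set" where
  "I_minus S i = {j \<in> pverts S. (j, i) \<in> parcs S}"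

definition balance_solution ::
    "'a pair_pre_digraph \<Rightarrow> ('a \<Rightarrow> real) \<Rightarrow> ('a \<times> 'a \<Rightarrow> real) \<Rightarrow> bool" where
  "balance_solution S a x \<longleftrightarrow>
     (\<forall>i \<in> pverts S. (\<Sum>j \<in> I_plus S i. x (i, j)) - (\<Sum>j \<in> I_minus S i. x (j, i)) = a i)"

text \<open>
  The library's \<^const>\<open>tree\<close> excludes directed cycles only, so cycles ignoring orientation are
  introduced here. Each arc \<open>e\<close> gives two steps: \<open>(e, True)\<close> traverses \<open>e\<close> along its direction,
  \<open>(e, False)\<close> against it. A cycle uses no arc twice; this rules out going back and forth along
  a single arc.
\<close>

definition steps :: "'a pair_pre_digraph \<Rightarrow> ('a, ('a \<times> 'a) \<times> bool) pre_digraph" where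
  "steps S = \<lparr> verts = pverts S, arcs = parcs S \<times> UNIV,
     tail = (\<lambda>(e, fwd). if fwd then fst e else snd e),
     head = (\<lambda>(e, fwd). if fwd then snd e else fst e) \<rparr>"

definition cycle_traversal :: "'a pair_pre_digraph \<Rightarrow> (('a \<times> 'a) \<times> bool) list \<Rightarrow> bool" where
  "cycle_traversal S p \<longleftrightarrow> pre_digraph.cycle (steps S) p \<and> distinct (map fst p)"

definition network_spanning_tree :: "'a pair_pre_digraph \<Rightarrow> ('a \<times> 'a) set \<Rightarrow> bool" where
  "network_spanning_tree S T \<longleftrightarrow>
     T \<subseteq> parcs S \<and> connected (S\<lparr>parcs := T\<rparr>) \<and> (\<nexists>p. cycle_traversal (S\<lparr>parcs := T\<rparr>) p)"

definition fundamental_cycle ::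
    "'a pair_pre_digraph \<Rightarrow> ('a \<times> 'a) set \<Rightarrow> 'a \<times> 'a \<Rightarrow> ('a \<times> 'a) set" where
  "fundamental_cycle S T e =
     (THE L. \<exists>p. cycle_traversal (S\<lparr>parcs := insert e T\<rparr>) p \<and> L = fst ` set p)"

text \<open>Traversals of the fundamental cycle of \<open>e\<close> in the direction given by \<open>e\<close>.\<close>

definition directed_traversal ::
    "'a pair_pre_digraph \<Rightarrow> ('a \<times> 'a) set \<Rightarrow> 'a \<times> 'a \<Rightarrow> (('a \<times> 'a) \<times> bool) list \<Rightarrow> bool" where
  "directed_traversal S T e p \<longleftrightarrow>
     cycle_traversal (S\<lparr>parcs := insert e T\<rparr>) p \<and> fst ` set p = fundamental_cycle S T e \<and>
     (e, True) \<in> set p"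

definition forward_arc ::
    "'a pair_pre_digraph \<Rightarrow> ('a \<times> 'a) set \<Rightarrow> 'a \<times> 'a \<Rightarrow> 'a \<times> 'a \<Rightarrow> bool" where
  "forward_arc S T e f \<longleftrightarrow> (\<exists>p. directed_traversal S T e p \<and> (f, True) \<in> set p)"

definition backward_arc ::
    "'a pair_pre_digraph \<Rightarrow> ('a \<times> 'a) set \<Rightarrow> 'a \<times> 'a \<Rightarrow> 'a \<times> 'a \<Rightarrow> bool" where
  "backward_arc S T e f \<longleftrightarrow> (\<exists>p. directed_traversal S T e p \<and> (f, False) \<in> set p)"

definition cycle_sign ::
    "'a pair_pre_digraph \<Rightarrow> ('a \<times> 'a) set \<Rightarrow> 'a \<times> 'a \<Rightarrow> 'a \<times> 'a \<Rightarrow> real" where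
  "cycle_sign S T e f =
     (if forward_arc S T e f then 1 else if backward_arc S T e f then -1 else 0)"

end

theory Submission
  imports Defs
begin

text \<open>
  A circulation supported on the tree vanishes: otherwise every node met by its support is met by
  at least two arcs of the support, and a longest path in the support closes up to a cycle. The sign
  vector of a cycle traversal is a circulation because its net outflow telescopes along the
  closed walk. If two traversals of cycles in \<open>insert e T\<close> use \<open>e\<close> in the same direction, the
  difference of their sign vectors is a circulation supported on the tree, hence zero; this makes
  the fundamental cycle and the signs well defined. Finally, the difference of two solutions is a
  circulation, and subtracting from it the combination of fundamental cycles with the same values
  off the tree leaves a circulation supported on the tree.
\<close>

section \<open>Steps of a network\<close>

lemma steps_simps [simp]:
  "verts (steps S) = pverts S"
  "arcs (steps S) = parcs S \<times> UNIV"
  "tail (steps S) s = (if snd s then fst (fst s) else snd (fst s))"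
  "head (steps S) s = (if snd s then snd (fst s) else fst (fst s))"
  by (auto simp: steps_def split: prod.splits)

lemma arcs_ends_steps: "arcs_ends (steps S) = parcs S \<union> (parcs S)\<inverse>"
proof (intro equalityI subrelI)
  fix u v
  assume "(u, v) \<in> parcs S \<union> (parcs S)\<inverse>"
  then show "(u, v) \<in> arcs_ends (steps S)"
    by (auto simp: arcs_ends_conv image_iff Bex_def)
qed (auto simp: arcs_ends_conv split: if_splits)

lemma (in pair_wf_digraph) wf_digraph_steps: "wf_digraph (steps G)"
  by unfold_locales (auto simp: wellformed')

lemma (in pair_fin_digraph) fin_digraph_steps: "fin_digraph (steps G)"
proof -
  interpret steps: wf_digraph "steps G" by (rule wf_digraph_steps)
  show ?thesis by unfold_locales (auto simp: pair_finite_verts pair_finite_arcs)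
qed

lemma (in pair_digraph) pair_digraph_update_parcs:
  assumes "F \<subseteq> parcs G"
  shows "pair_digraph (G\<lparr>parcs := F\<rparr>)"
  using assms wellformed' no_loops pair_finite_verts finite_subset[OF assms pair_finite_arcs]
  by unfold_locales auto

text \<open>\<open>connected\<close> speaks of the symmetric closure, which has the same nodes and
  arc ends as \<open>steps S\<close>. Reachability sees only these, so connectedness yields simple
  paths ignoring orientation.\<close>

lemma connected_steps_apath:
  assumes "pair_wf_digraph S" "connected S" "u \<in> pverts S" "v \<in> pverts S"
  obtains p where "pre_digraph.apath (steps S) u p v"
proof -
  interpret pair_wf_digraph S by fact
  interpret steps: wf_digraph "steps S" by (rule wf_digraph_steps)
  have "u \<rightarrow>\<^sup>*\<^bsub>mk_symmetric S\<^esub> v"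
    using assms by (auto simp: connected_def strongly_connected_def mk_symmetric_def)
  moreover have "arcs_ends (mk_symmetric S) = arcs_ends (steps S)"
    by (auto simp: arcs_ends_steps mk_symmetric_def)
  ultimately have "u \<rightarrow>\<^sup>*\<^bsub>steps S\<^esub> v"
    by (simp add: reachable_def mk_symmetric_def)
  then show thesis
    using that steps.reachable_apath by blast
qed

text \<open>Turns the reuse of an arc, in either direction, into the repetition of a node.\<close>

lemma awalk_verts_steps_arc_ends:
  assumes "pre_digraph.cas (steps S) u p v" "s \<in> set p"
  shows "{fst (fst s), snd (fst s)} \<subseteq> set (pre_digraph.awalk_verts (steps S) u p)"
  using assms
proof (induction p arbitrary: u)
  case (Cons t p)
  let ?w = "head (steps S) t"
  have "?w \<in> set (pre_digraph.awalk_verts (steps S) ?w p)"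
    using Cons.prems
    by (cases p) (simp_all add: pre_digraph.awalk_verts.simps pre_digraph.cas.simps del: steps_simps)
  then show ?case
    using Cons.IH[of ?w] Cons.prems
    by (auto simp: pre_digraph.awalk_verts.simps pre_digraph.cas.simps split: if_splits)
qed simp

text \<open>If the arc of the first step recurred, even reversed, the start node would be visited
  again.\<close>

lemma distinct_arcs_of_apath_steps:
  assumes "pre_digraph.cas (steps S) u p v" "distinct (pre_digraph.awalk_verts (steps S) u p)"
  shows "distinct (map fst p)"
  using assms
proof (induction p arbitrary: u)
  case (Cons s p)
  let ?w = "head (steps S) s"
  have p: "pre_digraph.cas (steps S) ?w p v"
    and u: "tail (steps S) s \<notin> set (pre_digraph.awalk_verts (steps S) ?w p)"
    and d: "distinct (pre_digraph.awalk_verts (steps S) ?w p)"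
    using Cons.prems by (auto simp: pre_digraph.awalk_verts.simps pre_digraph.cas.simps)
  have "fst s \<notin> fst ` set p"
  proof
    assume "fst s \<in> fst ` set p"
    then obtain t where t: "t \<in> set p" "fst t = fst s" by force
    then show False
      using awalk_verts_steps_arc_ends[OF p t(1)] u by (auto split: if_splits)
  qed
  then show ?case using Cons.IH[OF p d] by simp
qed simp

text \<open>The path \<open>p\<close> leads back to the start of the step \<open>(f, b)\<close>.
  Requiring \<open>f\<close> to be absent from \<open>p\<close> excludes going along
  \<open>f\<close> and straight back, which is a closed walk in \<open>steps S\<close> but uses one
  arc twice.\<close>

lemma cycle_traversal_ConsI:
  assumes "pair_wf_digraph S" "f \<in> parcs S"
    and p: "pre_digraph.apath (steps S) (head (steps S) (f, b)) p (tail (steps S) (f, b))"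
    and f: "f \<notin> fst ` set p"
  shows "cycle_traversal S ((f, b) # p)"
proof -
  interpret pair_wf_digraph S by fact
  interpret steps: wf_digraph "steps S" by (rule wf_digraph_steps)
  let ?u = "tail (steps S) (f, b)"
  have "steps.awalk ?u ((f, b) # p) ?u"
    using p assms(2) by (auto simp: steps.apath_def steps.awalk_Cons_iff simp del: steps_simps(3,4))
  moreover have "distinct (tl (steps.awalk_verts ?u ((f, b) # p)))"
    using p by (simp add: steps.apath_def del: steps_simps)
  moreover have "distinct (map fst ((f, b) # p))"
    using p f distinct_arcs_of_apath_steps[of S _ p] by (auto simp: steps.apath_def steps.awalk_def)
  ultimately show ?thesis
    by (auto simp: cycle_traversal_def steps.cycle_def)
qed

lemma cycle_traversal_arcs: "cycle_traversal S p \<Longrightarrow> fst ` set p \<subseteq> parcs S"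
  by (auto simp: cycle_traversal_def pre_digraph.cycle_def pre_digraph.awalk_def)

text \<open>Tails and heads of steps do not depend on the arc set, so walks can be moved between the
  network, the tree and the tree with one arc added.\<close>

lemma cas_steps_update_parcs:
  "pre_digraph.cas (steps (S\<lparr>parcs := A\<rparr>)) u p v = pre_digraph.cas (steps S) u p v"
  by (induction p arbitrary: u) (auto simp: pre_digraph.cas.simps)

lemma awalk_verts_steps_update_parcs:
  "pre_digraph.awalk_verts (steps (S\<lparr>parcs := A\<rparr>)) u p = pre_digraph.awalk_verts (steps S) u p"
  by (induction p arbitrary: u) (auto simp: pre_digraph.awalk_verts.simps)

lemma cycle_traversal_mono:
  assumes "cycle_traversal (S\<lparr>parcs := A\<rparr>) p" "fst ` set p \<subseteq> B"
  shows "cycle_traversal (S\<lparr>parcs := B\<rparr>) p"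
  using assms
  unfolding cycle_traversal_def pre_digraph.cycle_def pre_digraph.awalk_def
    cas_steps_update_parcs awalk_verts_steps_update_parcs
  by (fastforce simp: image_subset_iff)

text \<open>A longest path cannot be extended at its first node, so a second arc there closes a cycle.\<close>

lemma cycle_traversal_of_min_degree_two:
  assumes "pair_digraph S" and ne: "parcs S \<noteq> {}"
    and deg: "\<And>e v. e \<in> parcs S \<Longrightarrow> v \<in> {fst e, snd e} \<Longrightarrow>
      \<exists>f \<in> parcs S - {e}. v \<in> {fst f, snd f}"
  shows "\<exists>p. cycle_traversal S p"
proof -
  interpret pair_digraph S by fact
  interpret steps: fin_digraph "steps S" by (rule fin_digraph_steps)
  \<comment> \<open>The length of a simple path is bounded through the number of nodes, so a longest
    nonempty one exists; being nonempty, it has a first arc \<open>e\<close>.\<close>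
  define P where "P p \<longleftrightarrow> p \<noteq> [] \<and> (\<exists>u v. steps.apath u p v)" for p
  obtain e where e: "e \<in> parcs S" using ne by blast
  have "steps.apath (fst e) [(e, True)] (snd e)"
    using e no_loops[OF e] arc_fst_in_verts[OF e] arc_snd_in_verts[OF e]
    by (auto simp: steps.apath_def steps.awalk_def)
  then have "P [(e, True)]" by (auto simp: P_def)
  moreover have "\<forall>p. P p \<longrightarrow> length p < Suc (card (pverts S))"
    using steps.length_apath by (fastforce simp: P_def less_Suc_eq_le)
  ultimately obtain p where p: "P p" and max: "\<And>q. P q \<Longrightarrow> length q \<le> length p"
    using ex_has_greatest_nat[of P _ length] by blast
  then obtain u v e b p' where ap: "steps.apath u p v" and p_eq: "p = (e, b) # p'"
    unfolding P_def by (metis list.exhaust surj_pair)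
  have u: "u = tail (steps S) (e, b)" and e: "e \<in> parcs S"
    and u_notin: "u \<notin> set (steps.awalk_verts (head (steps S) (e, b)) p')"
    and p': "steps.awalk (head (steps S) (e, b)) p' v"
    using ap unfolding p_eq by (auto simp: steps.apath_def steps.awalk_Cons_iff simp del: steps_simps(3,4))
  have "u \<in> {fst e, snd e}" using u by auto
  then obtain f where f: "f \<in> parcs S" "f \<noteq> e" "u \<in> {fst f, snd f}"
    using deg[OF e] by blast
  \<comment> \<open>The direction \<open>c\<close> is chosen so that the step along \<open>f\<close>
    enters \<open>u\<close>.\<close>
  define c where "c = (u = snd f)"
  have fu: "head (steps S) (f, c) = u" using f by (auto simp: c_def)
  define w where "w = tail (steps S) (f, c)"
  \<comment> \<open>The arc \<open>f\<close> differs from the first arc \<open>e\<close>, and using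
    it later would bring the path back to \<open>u\<close>.\<close>
  have fp: "f \<notin> fst ` set p"
  proof
    assume "f \<in> fst ` set p"
    then obtain t where t: "t \<in> set p'" "fst t = f" using f(2) by (auto simp: p_eq)
    then have "fst f \<in> set (steps.awalk_verts (head (steps S) (e, b)) p')"
      "snd f \<in> set (steps.awalk_verts (head (steps S) (e, b)) p')"
      using awalk_verts_steps_arc_ends[of S _ p' v t] p' by (auto simp: steps.awalk_def)
    then show False using u_notin f(3) by auto
  qed
  \<comment> \<open>Otherwise prepending \<open>(f, c)\<close> would give a longer simple
    path.\<close>
  have w: "w \<in> set (steps.awalk_verts u p)"
  proof (rule ccontr)
    assume "w \<notin> set (steps.awalk_verts u p)"
    then have "steps.apath w ((f, c) # p) v"
      using ap f(1) fu
      by (auto simp: steps.apath_Cons_iff w_def simp del: steps_simps(3,4))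
    then have "P ((f, c) # p)" by (auto simp: P_def)
    then show False using max by fastforce
  qed
  \<comment> \<open>The initial segment \<open>q\<close> from \<open>u\<close> to \<open>w\<close>
    is closed up by the step \<open>(f, c)\<close> from \<open>w\<close> to
    \<open>u\<close>.\<close>
  obtain q r where qr: "p = q @ r" "steps.awalk u q w" "steps.awalk w r v"
    using steps.awalk_decomp[OF steps.awalkI_apath[OF ap] w] by blast
  then have "steps.apath u q w"
    using ap by (auto simp: steps.apath_append_iff steps.apath_def steps.awalk_verts_append)
  moreover have "f \<notin> fst ` set q" using fp qr(1) by auto
  ultimately have "cycle_traversal S ((f, c) # q)"
    using f(1) fu by (intro cycle_traversal_ConsI) (auto simp: w_def pair_wf_digraph simp del: steps_simps)
  then show ?thesis ..
qed

section \<open>Net outflow\<close>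

text \<open>The node-arc incidence matrix, with +1 at the tail and -1 at the head.\<close>

definition incidence :: "'a \<times> 'a \<Rightarrow> 'a \<Rightarrow> real" where
  "incidence e i = of_bool (fst e = i) - of_bool (snd e = i)"

text \<open>The left-hand side of the balance equation as a matrix-vector product. The arc set is a
  parameter so that the sum can be restricted to the tree.\<close>

definition net_outflow :: "('a \<times> 'a) set \<Rightarrow> ('a \<times> 'a \<Rightarrow> real) \<Rightarrow> 'a \<Rightarrow> real" where
  "net_outflow U x i = (\<Sum>e\<in>U. x e * incidence e i)"

lemma net_outflow_diff:
  "net_outflow U (\<lambda>e. x e - y e) i = net_outflow U x i - net_outflow U y i"
  by (simp add: net_outflow_def left_diff_distrib sum_subtractf)

lemma net_outflow_add:
  "net_outflow U (\<lambda>e. x e + y e) i = net_outflow U x i + net_outflow U y i"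
  by (simp add: net_outflow_def distrib_right sum.distrib)

lemma net_outflow_sum:
  "net_outflow U (\<lambda>e. \<Sum>k\<in>K. c k * x k e) i = (\<Sum>k\<in>K. c k * net_outflow U (x k) i)"
  unfolding net_outflow_def sum_distrib_left sum_distrib_right
  by (subst sum.swap) (simp add: mult.assoc)

lemma net_outflow_cong:
  "(\<And>e. e \<in> U \<Longrightarrow> x e = y e) \<Longrightarrow> net_outflow U x i = net_outflow U y i"
  by (simp add: net_outflow_def)

lemma net_outflow_mono_neutral:
  assumes "finite U" "T \<subseteq> U" "\<And>e. e \<in> U - T \<Longrightarrow> x e = 0"
  shows "net_outflow U x i = net_outflow T x i"
  unfolding net_outflow_def using assms by (intro sum.mono_neutral_right) auto

lemma balance_solution_iff_net_outflow:
  assumes "pair_fin_digraph S"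
  shows "balance_solution S a x \<longleftrightarrow> (\<forall>i\<in>pverts S. net_outflow (parcs S) x i = a i)"
proof -
  interpret pair_fin_digraph S by fact
  have "(\<Sum>j\<in>I_plus S i. x (i, j)) - (\<Sum>j\<in>I_minus S i. x (j, i)) = net_outflow (parcs S) x i" for i
  proof -
    have "(\<Sum>j\<in>I_plus S i. x (i, j)) = (\<Sum>e\<in>{e \<in> parcs S. fst e = i}. x e)"
      by (rule sum.reindex_bij_witness[of _ snd "\<lambda>j. (i, j)"])
        (auto simp: I_plus_def wellformed')
    also have "\<dots> = (\<Sum>e\<in>parcs S. x e * of_bool (fst e = i))"
      by (rule sum.mono_neutral_cong_left) (auto simp: pair_finite_arcs)
    finally have out_sum: "(\<Sum>j\<in>I_plus S i. x (i, j)) = \<dots>" .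
    have "(\<Sum>j\<in>I_minus S i. x (j, i)) = (\<Sum>e\<in>{e \<in> parcs S. snd e = i}. x e)"
      by (rule sum.reindex_bij_witness[of _ fst "\<lambda>j. (j, i)"])
        (auto simp: I_minus_def wellformed')
    also have "\<dots> = (\<Sum>e\<in>parcs S. x e * of_bool (snd e = i))"
      by (rule sum.mono_neutral_cong_left) (auto simp: pair_finite_arcs)
    finally show ?thesis
      using out_sum by (simp add: net_outflow_def incidence_def right_diff_distrib sum_subtractf)
  qed
  then show ?thesis by (simp add: balance_solution_def)
qed

lemma balance_solution_iff_circulation:
  assumes "pair_fin_digraph S" "balance_solution S a x"
  shows "balance_solution S a y \<longleftrightarrow>
    (\<forall>i\<in>pverts S. net_outflow (parcs S) (\<lambda>e. y e - x e) i = 0)"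
  using assms by (auto simp: balance_solution_iff_net_outflow net_outflow_diff)

lemma cycle_free_circulation_eq_0:
  assumes "pair_digraph S" and acyclic: "\<nexists>p. cycle_traversal S p"
    and circ: "\<And>i. i \<in> pverts S \<Longrightarrow> net_outflow (parcs S) x i = 0"
    and e: "e \<in> parcs S"
  shows "x e = 0"
proof (rule ccontr)
  assume nz: "x e \<noteq> 0"
  interpret pair_digraph S by fact
  define F where "F = {f \<in> parcs S. x f \<noteq> 0}"
  have F: "F \<subseteq> parcs S" by (auto simp: F_def)
  interpret F: pair_digraph "S\<lparr>parcs := F\<rparr>" by (rule pair_digraph_update_parcs) fact
  have "\<exists>g \<in> F - {f}. v \<in> {fst g, snd g}" if f: "f \<in> F" and v: "v \<in> {fst f, snd f}" for f v
  proof (rule ccontr)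
    assume "\<not> (\<exists>g \<in> F - {f}. v \<in> {fst g, snd g})"
    then have other: "x g * incidence g v = 0" if "g \<in> parcs S - {f}" for g
      using that by (auto simp: F_def incidence_def)
    \<comment> \<open>If \<open>f\<close> were the only arc of the support at \<open>v\<close>,
      nothing could cancel its contribution, which is nonzero because \<open>f\<close> is not a
      loop.\<close>
    have "net_outflow (parcs S) x v = (\<Sum>g\<in>{f}. x g * incidence g v)"
      unfolding net_outflow_def using f F other
      by (intro sum.mono_neutral_right) (auto simp: pair_finite_arcs)
    moreover have "incidence f v \<noteq> 0"
      using v f F no_loops[of f] by (auto simp: incidence_def)
    ultimately have "net_outflow (parcs S) x v \<noteq> 0"
      using f by (simp add: F_def)
    moreover have "v \<in> pverts S"
      using v f F arc_fst_in_verts arc_snd_in_verts by blast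
    ultimately show False using circ by blast
  qed
  moreover have "e \<in> F" using e nz by (simp add: F_def)
  ultimately obtain p where p: "cycle_traversal (S\<lparr>parcs := F\<rparr>) p"
    using cycle_traversal_of_min_degree_two[OF F.pair_digraph] by fastforce
  then have "cycle_traversal (S\<lparr>parcs := parcs S\<rparr>) p"
    using cycle_traversal_arcs[OF p] F by (intro cycle_traversal_mono[OF p]) simp
  then show False using acyclic by simp
qed

section \<open>Sign vectors of cycle traversals\<close>

text \<open>A sum over the list is additive in the steps, which suits induction along a walk;
  \<open>traversal_sign_eq\<close> recovers the case distinction when no arc repeats.\<close>

definition traversal_sign :: "('e \<times> bool) list \<Rightarrow> 'e \<Rightarrow> real" where
  "traversal_sign p f = (\<Sum>(g, b)\<leftarrow>p. if g = f then (if b then 1 else -1) else 0)"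

lemma traversal_sign_eq:
  assumes "distinct (map fst p)"
  shows "traversal_sign p f = (if (f, True) \<in> set p then 1 else if (f, False) \<in> set p then -1 else 0)"
  using assms
proof (induction p)
  case (Cons s p)
  obtain g b where s: "s = (g, b)" by fastforce
  have "g \<notin> fst ` set p" using Cons.prems by (simp add: s)
  then have "(g, c) \<notin> set p" for c by force
  moreover have "traversal_sign (s # p) f
      = (if g = f then (if b then 1 else -1) else 0) + traversal_sign p f"
    by (simp add: traversal_sign_def s)
  ultimately show ?case using Cons by (auto simp: s)
qed (simp add: traversal_sign_def)

lemma traversal_sign_eq_0_iff:
  assumes "distinct (map fst p)"
  shows "traversal_sign p f = 0 \<longleftrightarrow> f \<notin> fst ` set p"
proof -
  have "f \<in> fst ` set p \<longleftrightarrow> (f, True) \<in> set p \<or> (f, False) \<in> set p"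
    by (auto simp: image_iff Bex_def) (metis (full_types))
  then show ?thesis using traversal_sign_eq[OF assms] by auto
qed

text \<open>A step adds +1 at its start and -1 at its end, in whichever direction it runs along its
  arc, so interior nodes cancel. The induction needs open walks; the closed case
  \<open>u = v\<close> is the one used.\<close>

lemma net_outflow_traversal_sign:
  assumes "finite U" "fst ` set p \<subseteq> U" "pre_digraph.cas (steps S) u p v"
  shows "net_outflow U (traversal_sign p) i = of_bool (u = i) - of_bool (v = i)"
  using assms(2,3)
proof (induction p arbitrary: u)
  case Nil
  then show ?case
    by (simp add: net_outflow_def traversal_sign_def pre_digraph.cas.simps)
next
  case (Cons s p)
  obtain g b where s: "s = (g, b)" by fastforce
  have "net_outflow U (traversal_sign (s # p)) i
      = net_outflow U (\<lambda>f. if g = f then (if b then 1 else -1) else 0) i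
        + net_outflow U (traversal_sign p) i"
    unfolding net_outflow_add[symmetric] by (rule net_outflow_cong) (simp add: traversal_sign_def s)
  moreover have "net_outflow U (\<lambda>f. if g = f then (if b then 1 else -1) else 0) i
      = (if b then incidence g i else - incidence g i)"
  proof -
    have "net_outflow U (\<lambda>f. if g = f then (if b then 1 else -1) else 0) i
        = (\<Sum>f\<in>U. if g = f then (if b then 1 else -1) * incidence f i else 0)"
      unfolding net_outflow_def by (intro sum.cong) auto
    then show ?thesis using Cons.prems assms(1) by (simp add: s)
  qed
  moreover have "net_outflow U (traversal_sign p) i
      = of_bool (head (steps S) s = i) - of_bool (v = i)"
    using Cons by (simp add: pre_digraph.cas.simps del: steps_simps)
  moreover have "u = tail (steps S) s"
    using Cons.prems by (simp add: pre_digraph.cas.simps)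
  ultimately show ?case
    by (simp add: s incidence_def)
qed

lemma net_outflow_cycle_traversal:
  assumes "finite U" "parcs S \<subseteq> U" "cycle_traversal S p"
  shows "net_outflow U (traversal_sign p) i = 0"
proof -
  obtain u where "pre_digraph.cas (steps S) u p u"
    using assms(3) by (auto simp: cycle_traversal_def pre_digraph.cycle_def pre_digraph.awalk_def)
  then show ?thesis
    using net_outflow_traversal_sign[of U p S u u i] assms cycle_traversal_arcs[OF assms(3)] by auto
qed

section \<open>Fundamental cycles\<close>

locale spanning_tree_network = pair_digraph S for S :: "'a pair_pre_digraph" +
  fixes T :: "('a \<times> 'a) set"
  assumes spanning_tree: "network_spanning_tree S T"
begin

lemma tree_subset: "T \<subseteq> parcs S"
  using spanning_tree by (simp add: network_spanning_tree_def)

text \<open>Since \<open>x\<close> vanishes off the tree, it is a circulation of the cycle-free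
  network with arc set \<open>T\<close>. Applied to differences, this shows that a circulation is
  determined by its values off the tree.\<close>

lemma tree_circulation_eq_0:
  assumes "\<And>i. i \<in> pverts S \<Longrightarrow> net_outflow (parcs S) x i = 0"
    and "\<And>e. e \<in> parcs S - T \<Longrightarrow> x e = 0" and "e \<in> T"
  shows "x e = 0"
proof (rule cycle_free_circulation_eq_0)
  show "pair_digraph (S\<lparr>parcs := T\<rparr>)"
    by (rule pair_digraph_update_parcs) (rule tree_subset)
  show "\<nexists>p. cycle_traversal (S\<lparr>parcs := T\<rparr>) p"
    using spanning_tree by (simp add: network_spanning_tree_def)
  show "net_outflow (parcs (S\<lparr>parcs := T\<rparr>)) x i = 0" if "i \<in> pverts (S\<lparr>parcs := T\<rparr>)" for i
    using that assms net_outflow_mono_neutral[OF pair_finite_arcs tree_subset, of x i] by simp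
  show "e \<in> parcs (S\<lparr>parcs := T\<rparr>)" using assms by simp
qed

text \<open>The tree connects the head of \<open>e\<close> to its tail by a simple path, and this
  path avoids \<open>e\<close> because \<open>e\<close> is not in \<open>T\<close>.\<close>

lemma cycle_through_arc_exists:
  assumes e: "e \<in> parcs S - T"
  obtains p where "cycle_traversal (S\<lparr>parcs := insert e T\<rparr>) p" "(e, True) \<in> set p"
proof -
  let ?T = "S\<lparr>parcs := T\<rparr>" and ?C = "S\<lparr>parcs := insert e T\<rparr>"
  interpret T: pair_digraph ?T by (rule pair_digraph_update_parcs) (rule tree_subset)
  interpret C: pair_digraph ?C
    by (rule pair_digraph_update_parcs) (use tree_subset e in auto)
  have "connected ?T" using spanning_tree by (simp add: network_spanning_tree_def)
  then obtain p where p: "pre_digraph.apath (steps ?T) (snd e) p (fst e)"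
    using e arc_fst_in_verts arc_snd_in_verts
    by (auto elim!: connected_steps_apath[OF T.pair_wf_digraph, of "snd e" "fst e"])
  have "pre_digraph.apath (steps ?C) (snd e) p (fst e)"
    using p
    unfolding pre_digraph.apath_def pre_digraph.awalk_def
      cas_steps_update_parcs awalk_verts_steps_update_parcs
    by auto
  moreover have "e \<notin> fst ` set p"
    using p e by (auto simp: pre_digraph.apath_def pre_digraph.awalk_def)
  ultimately have "cycle_traversal ?C ((e, True) # p)"
    by (intro cycle_traversal_ConsI) (auto simp: C.pair_wf_digraph)
  then show thesis by (rule that) simp
qed

lemma cycle_contains_arc:
  assumes p: "cycle_traversal (S\<lparr>parcs := insert e T\<rparr>) p"
  shows "e \<in> fst ` set p"
proof (rule ccontr)
  assume "e \<notin> fst ` set p"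
  then have "cycle_traversal (S\<lparr>parcs := T\<rparr>) p"
    using cycle_traversal_mono[OF p] cycle_traversal_arcs[OF p] by auto
  then show False using spanning_tree by (auto simp: network_spanning_tree_def)
qed

text \<open>The factor \<open>traversal_sign _ e\<close> is \<open>\<plusminus>1\<close>; it compensates for the direction of travel.\<close>

lemma traversal_sign_unique:
  assumes e: "e \<in> parcs S - T"
    and p: "cycle_traversal (S\<lparr>parcs := insert e T\<rparr>) p"
    and q: "cycle_traversal (S\<lparr>parcs := insert e T\<rparr>) q"
  shows "traversal_sign q e * traversal_sign p f = traversal_sign p e * traversal_sign q f"
proof -
  \<comment> \<open>Cross-multiplying makes the two terms cancel at \<open>e\<close>, so the
    circulation \<open>d\<close> is supported on the tree.\<close>
  define d where
    "d f = traversal_sign q e * traversal_sign p f - traversal_sign p e * traversal_sign q f" for f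
  have sub: "parcs (S\<lparr>parcs := insert e T\<rparr>) \<subseteq> parcs S" using e tree_subset by auto
  have out_p: "traversal_sign p f = 0" and out_q: "traversal_sign q f = 0" if "f \<notin> insert e T" for f
    using that p q cycle_traversal_arcs[OF p] cycle_traversal_arcs[OF q]
    by (auto simp: cycle_traversal_def traversal_sign_eq_0_iff)
  have scale: "net_outflow (parcs S) (\<lambda>f. c * x f) i = c * net_outflow (parcs S) x i" for c x i
    by (simp add: net_outflow_def sum_distrib_left mult.assoc)
  have "net_outflow (parcs S) d i = 0" for i
    unfolding d_def net_outflow_diff scale
    using net_outflow_cycle_traversal[OF pair_finite_arcs sub] p q by simp
  moreover have off: "d f = 0" if "f \<notin> T" for f
    using that out_p out_q by (cases "f = e") (auto simp: d_def)
  ultimately have "d f = 0"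
    using tree_circulation_eq_0[of d f] by (cases "f \<in> T") auto
  then show ?thesis by (simp add: d_def)
qed

text \<open>By \<open>traversal_sign_unique\<close> the sign vectors of two such cycles are
  proportional with nonzero factors, hence have the same support, and the support is the arc set of
  the cycle.\<close>

lemma fundamental_cycle_eq:
  assumes e: "e \<in> parcs S - T" and p: "cycle_traversal (S\<lparr>parcs := insert e T\<rparr>) p"
  shows "fundamental_cycle S T e = fst ` set p"
  unfolding fundamental_cycle_def
proof (rule the_equality)
  fix L assume "\<exists>q. cycle_traversal (S\<lparr>parcs := insert e T\<rparr>) q \<and> L = fst ` set q"
  then obtain q where q: "cycle_traversal (S\<lparr>parcs := insert e T\<rparr>) q" and L: "L = fst ` set q"
    by blast
  have dist: "distinct (map fst p)" "distinct (map fst q)"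
    using p q by (auto simp: cycle_traversal_def)
  have "traversal_sign p e \<noteq> 0" "traversal_sign q e \<noteq> 0"
    using cycle_contains_arc p q dist by (auto simp: traversal_sign_eq_0_iff)
  then have "traversal_sign q f = 0 \<longleftrightarrow> traversal_sign p f = 0" for f
    using traversal_sign_unique[OF e p q, of f] by (metis mult_eq_0_iff)
  then have "f \<in> fst ` set q \<longleftrightarrow> f \<in> fst ` set p" for f
    using dist by (simp add: traversal_sign_eq_0_iff)
  then show "L = fst ` set p"
    unfolding L by (rule set_eqI)
qed (use p in blast)

text \<open>\<open>forward_arc\<close> and \<open>backward_arc\<close> range over all directed
  traversals. These all have the same sign vector, so any one of them can be used for
  computing.\<close>

lemma cycle_sign_eq_traversal_sign:
  assumes e: "e \<in> parcs S - T"
    and p: "cycle_traversal (S\<lparr>parcs := insert e T\<rparr>) p" "(e, True) \<in> set p"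
  shows "cycle_sign S T e f = traversal_sign p f"
proof -
  have dist: "distinct (map fst q)" if "directed_traversal S T e q" for q
    using that by (auto simp: directed_traversal_def cycle_traversal_def)
  have dir: "directed_traversal S T e p"
    using p fundamental_cycle_eq[OF e p(1)] by (simp add: directed_traversal_def)
  have same: "traversal_sign q f = traversal_sign p f" if q: "directed_traversal S T e q" for q
  proof -
    \<comment> \<open>Both traversals run along \<open>e\<close> forwards, so the factors in
      \<open>traversal_sign_unique\<close> are 1.\<close>
    have "traversal_sign q e = 1" "traversal_sign p e = 1"
      using q p(2) dist[OF q] dist[OF dir] by (auto simp: traversal_sign_eq directed_traversal_def)
    then show ?thesis
      using traversal_sign_unique[OF e p(1), of q f] q by (auto simp: directed_traversal_def)
  qed
  have fwd: "(f, True) \<in> set q \<longleftrightarrow> traversal_sign p f = 1"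
    if "directed_traversal S T e q" for q
    using same[OF that] traversal_sign_eq[OF dist[OF that], of f] by (auto split: if_splits)
  \<comment> \<open>Excluding sign 1 mirrors the order of the tests in \<open>cycle_sign\<close>,
    where forward comes first.\<close>
  have bwd: "(f, False) \<in> set q \<longleftrightarrow> traversal_sign p f = -1"
    if "directed_traversal S T e q" "traversal_sign p f \<noteq> 1" for q
    using that same[OF that(1)] traversal_sign_eq[OF dist[OF that(1)], of f] by (auto split: if_splits)
  have "forward_arc S T e f \<longleftrightarrow> traversal_sign p f = 1"
    using fwd dir by (auto simp: forward_arc_def)
  moreover have "backward_arc S T e f \<longleftrightarrow> traversal_sign p f = -1" if "traversal_sign p f \<noteq> 1"
    using bwd[OF _ that] dir by (auto simp: backward_arc_def)
  ultimately show ?thesis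
    using traversal_sign_eq[OF dist[OF dir], of f] by (auto simp: cycle_sign_def)
qed

lemma net_outflow_cycle_sign:
  assumes e: "e \<in> parcs S - T"
  shows "net_outflow (parcs S) (cycle_sign S T e) i = 0"
proof -
  obtain p where p: "cycle_traversal (S\<lparr>parcs := insert e T\<rparr>) p" "(e, True) \<in> set p"
    using cycle_through_arc_exists[OF e] .
  have "cycle_sign S T e = traversal_sign p"
    using cycle_sign_eq_traversal_sign[OF e p] by (simp add: fun_eq_iff)
  then show ?thesis
    using net_outflow_cycle_traversal[OF pair_finite_arcs _ p(1)] e tree_subset by simp
qed

text \<open>The cycle lies in \<open>insert e T\<close>, so \<open>e\<close> is its only arc off the
  tree, and it is traversed forwards. Thus the values off the tree serve as coordinates for
  combinations of fundamental cycles.\<close>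

lemma cycle_sign_off_tree:
  assumes e: "e \<in> parcs S - T" and f: "f \<notin> T"
  shows "cycle_sign S T e f = of_bool (e = f)"
proof -
  obtain p where p: "cycle_traversal (S\<lparr>parcs := insert e T\<rparr>) p" "(e, True) \<in> set p"
    using cycle_through_arc_exists[OF e] .
  have "distinct (map fst p)" using p(1) by (simp add: cycle_traversal_def)
  then have "traversal_sign p f = of_bool (e = f)"
    using f p(2) cycle_traversal_arcs[OF p(1)]
    by (cases "e = f") (auto simp: traversal_sign_eq traversal_sign_eq_0_iff)
  then show ?thesis using cycle_sign_eq_traversal_sign[OF e p] by simp
qed

section \<open>Combinations of fundamental cycles and the general solution\<close>

definition cycle_combination :: "('a \<times> 'a \<Rightarrow> real) \<Rightarrow> 'a \<times> 'a \<Rightarrow> real" where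
  "cycle_combination x f = (\<Sum>e\<in>parcs S - T. x e * cycle_sign S T e f)"

lemma net_outflow_cycle_combination: "net_outflow (parcs S) (cycle_combination x) i = 0"
proof -
  have "cycle_combination x = (\<lambda>f. \<Sum>e\<in>parcs S - T. x e * cycle_sign S T e f)"
    by (simp add: cycle_combination_def fun_eq_iff)
  then have "net_outflow (parcs S) (cycle_combination x) i
      = (\<Sum>e\<in>parcs S - T. x e * net_outflow (parcs S) (cycle_sign S T e) i)"
    using net_outflow_sum by simp
  then show ?thesis by (simp add: net_outflow_cycle_sign)
qed

lemma cycle_combination_off_tree:
  assumes "f \<in> parcs S - T"
  shows "cycle_combination x f = x f"
proof -
  have "cycle_combination x f = (\<Sum>e\<in>parcs S - T. if e = f then x e else 0)"
    unfolding cycle_combination_def using assms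
    by (intro sum.cong) (auto simp: cycle_sign_off_tree)
  then show ?thesis using assms pair_finite_arcs by simp
qed

lemma cycle_combination_diff:
  "cycle_combination (\<lambda>e. x e - y e) f = cycle_combination x f - cycle_combination y f"
  by (simp add: cycle_combination_def left_diff_distrib sum_subtractf)

text \<open>Left to right, \<open>x\<close> minus its combination is a circulation vanishing off the
  tree, hence zero on it. Right to left, \<open>x\<close> agrees with its combination on all arcs,
  since off the tree this always holds.\<close>

lemma circulation_iff_cycle_combination:
  "(\<forall>i\<in>pverts S. net_outflow (parcs S) x i = 0) \<longleftrightarrow> (\<forall>f\<in>T. x f = cycle_combination x f)"
proof
  assume circ: "\<forall>i\<in>pverts S. net_outflow (parcs S) x i = 0"
  show "\<forall>f\<in>T. x f = cycle_combination x f"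
  proof
    fix f assume f: "f \<in> T"
    have circ':  "net_outflow (parcs S) (\<lambda>f. x f - cycle_combination x f) i = 0"
      if "i \<in> pverts S" for i
      unfolding net_outflow_diff using circ that by (simp add: net_outflow_cycle_combination)
    have "x f - cycle_combination x f = 0"
      using tree_circulation_eq_0[OF circ' _ f] by (simp add: cycle_combination_off_tree)
    then show "x f = cycle_combination x f" by simp
  qed
next
  assume "\<forall>f\<in>T. x f = cycle_combination x f"
  then have "net_outflow (parcs S) x i = net_outflow (parcs S) (cycle_combination x) i" for i
    by (intro net_outflow_cong) (metis DiffI cycle_combination_off_tree)
  then show "\<forall>i\<in>pverts S. net_outflow (parcs S) x i = 0"
    by (simp add: net_outflow_cycle_combination)
qed

text \<open>This is the criterion for circulations applied to \<open>x\<close> minus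
  \<open>xt\<close>, using linearity of \<open>cycle_combination\<close>.\<close>

lemma balance_solution_iff_cycle_combination:
  assumes "balance_solution S a xt"
  shows "balance_solution S a x \<longleftrightarrow>
    (\<forall>f\<in>T. x f = cycle_combination x f + (xt f - cycle_combination xt f))"
  unfolding balance_solution_iff_circulation[OF pair_fin_digraph assms]
    circulation_iff_cycle_combination cycle_combination_diff
  by (auto simp: algebra_simps)

lemma balance_solution_extending:
  assumes "balance_solution S a xt"
  shows "\<exists>x. balance_solution S a x \<and> (\<forall>e\<in>parcs S - T. x e = y e)"
proof (intro exI conjI ballI)
  \<comment> \<open>Adding a circulation preserves the balance equations; this one is chosen to have
    the values of \<open>y\<close> minus \<open>xt\<close> off the tree.\<close>
  let ?x = "\<lambda>e. xt e + cycle_combination (\<lambda>e. y e - xt e) e"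
  show "balance_solution S a ?x"
    unfolding balance_solution_iff_circulation[OF pair_fin_digraph assms]
    by (simp add: net_outflow_cycle_combination)
  show "?x e = y e" if "e \<in> parcs S - T" for e
    using that by (simp add: cycle_combination_off_tree)
qed

end

theorem theorem3:
  fixes S :: "'a pair_pre_digraph" and UT :: "('a \<times> 'a) set"
    and a :: "'a \<Rightarrow> real" and xt :: "'a \<times> 'a \<Rightarrow> real"
  assumes "pair_digraph S"
    and "connected S"
    and "network_spanning_tree S UT"
    and "balance_solution S a xt"
  shows "(\<forall>x :: 'a \<times> 'a \<Rightarrow> real. balance_solution S a x \<longleftrightarrow>
            (\<forall>(i, j) \<in> UT.
               x (i, j) =
                 (\<Sum>(\<tau>, \<rho>) \<in> parcs S - UT. x (\<tau>, \<rho>) * cycle_sign S UT (\<tau>, \<rho>) (i, j))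
               + (xt (i, j) -
                   (\<Sum>(\<tau>, \<rho>) \<in> parcs S - UT. xt (\<tau>, \<rho>) * cycle_sign S UT (\<tau>, \<rho>) (i, j)))))
       \<and> (\<forall>y :: 'a \<times> 'a \<Rightarrow> real. \<exists>x. balance_solution S a x \<and>
            (\<forall>(\<tau>, \<rho>) \<in> parcs S - UT. x (\<tau>, \<rho>) = y (\<tau>, \<rho>)))"
proof -
  interpret pair_digraph S by fact
  interpret spanning_tree_network S UT by unfold_locales fact
  have comb: "(\<Sum>(\<tau>, \<rho>) \<in> parcs S - UT. x (\<tau>, \<rho>) * cycle_sign S UT (\<tau>, \<rho>) f)
      = cycle_combination x f" for x f
    unfolding cycle_combination_def by (rule sum.cong) auto
  show ?thesis
    unfolding comb balance_solution_iff_cycle_combination[OF assms(4), symmetric]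
    using balance_solution_iff_cycle_combination[OF assms(4)]
      balance_solution_extending[OF assms(4)]
    by (auto simp: case_prod_unfold)
qed

end
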